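(* Let $L:\mathcal{B}\to\mathcal{A}$ be left adjoint to $R:\mathcal{A}\to\mathcal{B}$, with unit $\eta:\mathrm{Id}_{\mathcal{B}}\to RL$ and counit $\epsilon:LR\to\mathrm{Id}_{\mathcal{A}}$. (i) $L$ is h-separable if and only if there is a natural transformation $\gamma:RL\to\mathrm{Id}_{\mathcal{B}}$ such that $\gamma\circ\eta=\mathrm{Id}$ and $\gamma\gamma=\gamma\circ R\epsilon L$. (ii) $R$ is h-separable if and only if there is a natural transformation $\delta:\mathrm{Id}_{\mathcal{A}}\to LR$ such that $\epsilon\circ\delta=\mathrm{Id}$ and $\delta\delta=L\eta R\circ\delta$.
   Context: A functor $F:\mathcal{B}\to\mathcal{A}$ is h-separable (heavily separable) if there are maps $P_{X,Y}:\mathrm{Hom}_{\mathcal{A}}(FX,FY)\to\mathrm{Hom}_{\mathcal{B}}(X,Y)$, natural in $X,Y\in\mathcal{B}$, such that $P_{X,Y}(Ff)=f$ for every $f:X\to Y$ in $\mathcal{B}$, and $P_{X,Z}(f\circ g)=P_{Y,Z}(f)\circ P_{X,Y}(g)$ for all $X,Y,Z\in\mathcal{B}$ and all $g:FX\to FY$, $f:FY\to FZ$ in $\mathcal{A}$. Notation: $\gamma\gamma:RLRL\to\mathrm{Id}_{\mathcal B}$ is the horizontal composite, $\gamma\gamma=\gamma\circ RL\gamma=\gamma\circ\gamma RL$; likewise $\delta\delta=LR\delta\circ\delta=\delta LR\circ\delta:\mathrm{Id}_{\mathcal A}\to LRLR$. *)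

theory Defs
  imports "HOL-Library.FuncSet"
begin

record ('o, 'a) cat =
  Obj :: "'o set"
  Arr :: "'a set"
  Dom :: "'a \<Rightarrow> 'o"
  Cod :: "'a \<Rightarrow> 'o"
  Idn :: "'o \<Rightarrow> 'a"
  Comp :: "'a \<Rightarrow> 'a \<Rightarrow> 'a"  (infixl "\<cdot>\<index>" 70)

definition hom :: "('o, 'a) cat \<Rightarrow> 'o \<Rightarrow> 'o \<Rightarrow> 'a set" where
  "hom C X Y = {f \<in> Arr C. Dom C f = X \<and> Cod C f = Y}"

text \<open>Composition is in applicative order: the arrow \<open>g \<cdot>\<^bsub>C\<^esub> f\<close> is ``first \<open>f\<close>, then \<open>g\<close>''.\<close>

locale category =
  fixes C :: "('o, 'a) cat"
  assumes Dom_Obj: "f \<in> Arr C \<Longrightarrow> Dom C f \<in> Obj C"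
    and Cod_Obj: "f \<in> Arr C \<Longrightarrow> Cod C f \<in> Obj C"
    and Idn_hom: "X \<in> Obj C \<Longrightarrow> Idn C X \<in> hom C X X"
    and Comp_hom: "\<lbrakk>f \<in> hom C X Y; g \<in> hom C Y Z\<rbrakk> \<Longrightarrow> g \<cdot>\<^bsub>C\<^esub> f \<in> hom C X Z"
    and Comp_Idn: "f \<in> hom C X Y \<Longrightarrow> f \<cdot>\<^bsub>C\<^esub> Idn C X = f"
    and Idn_Comp: "f \<in> hom C X Y \<Longrightarrow> Idn C Y \<cdot>\<^bsub>C\<^esub> f = f"
    and Comp_assoc: "\<lbrakk>f \<in> hom C X Y; g \<in> hom C Y Z; h \<in> hom C Z W\<rbrakk>
      \<Longrightarrow> (h \<cdot>\<^bsub>C\<^esub> g) \<cdot>\<^bsub>C\<^esub> f = h \<cdot>\<^bsub>C\<^esub> (g \<cdot>\<^bsub>C\<^esub> f)"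

record ('o1, 'a1, 'o2, 'a2) func =
  FO :: "'o1 \<Rightarrow> 'o2"
  FA :: "'a1 \<Rightarrow> 'a2"

locale cat_functor = dom: category C + cod: category D
  for C :: "('o1, 'a1) cat" and D :: "('o2, 'a2) cat" +
  fixes F :: "('o1, 'a1, 'o2, 'a2) func"
  assumes FO_Obj: "X \<in> Obj C \<Longrightarrow> FO F X \<in> Obj D"
    and FA_hom: "f \<in> hom C X Y \<Longrightarrow> FA F f \<in> hom D (FO F X) (FO F Y)"
    and FA_Idn: "X \<in> Obj C \<Longrightarrow> FA F (Idn C X) = Idn D (FO F X)"
    and FA_Comp: "\<lbrakk>f \<in> hom C X Y; g \<in> hom C Y Z\<rbrakk>
      \<Longrightarrow> FA F (g \<cdot>\<^bsub>C\<^esub> f) = FA F g \<cdot>\<^bsub>D\<^esub> FA F f"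

definition id_func :: "('o, 'a, 'o, 'a) func" where
  "id_func = \<lparr>FO = (\<lambda>X. X), FA = (\<lambda>f. f)\<rparr>"

definition comp_func ::
  "('o2, 'a2, 'o3, 'a3) func \<Rightarrow> ('o1, 'a1, 'o2, 'a2) func \<Rightarrow> ('o1, 'a1, 'o3, 'a3) func"
  (infixr "\<circ>\<^sub>F" 75)
  where "G \<circ>\<^sub>F F = \<lparr>FO = (\<lambda>X. FO G (FO F X)), FA = (\<lambda>f. FA G (FA F f))\<rparr>"

locale nat_trans = F: cat_functor C D F + G: cat_functor C D G
  for C :: "('o1, 'a1) cat" and D :: "('o2, 'a2) cat" and F G +
  fixes \<alpha> :: "'o1 \<Rightarrow> 'a2"
  assumes component_hom: "X \<in> Obj C \<Longrightarrow> \<alpha> X \<in> hom D (FO F X) (FO G X)"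
    and naturality: "f \<in> hom C X Y \<Longrightarrow> \<alpha> Y \<cdot>\<^bsub>D\<^esub> FA F f = FA G f \<cdot>\<^bsub>D\<^esub> \<alpha> X"

text \<open>The values of a natural transformation outside the objects of its source category are
  irrelevant. All operations below restrict their result to these objects, so that an equation
  between two results says exactly that the components at all objects agree. In each of them
  \<open>C\<close> is the source category of the resulting transformation.\<close>

definition id_nt :: "('o1, 'a1) cat \<Rightarrow> ('o2, 'a2) cat \<Rightarrow> ('o1, 'a1, 'o2, 'a2) func \<Rightarrow> 'o1 \<Rightarrow> 'a2" where
  "id_nt C D F = (\<lambda>X\<in>Obj C. Idn D (FO F X))"

definition vcomp ::
  "('o1, 'a1) cat \<Rightarrow> ('o2, 'a2) cat \<Rightarrow> ('o1 \<Rightarrow> 'a2) \<Rightarrow> ('o1 \<Rightarrow> 'a2) \<Rightarrow> 'o1 \<Rightarrow> 'a2" where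
  "vcomp C D \<beta> \<alpha> = (\<lambda>X\<in>Obj C. \<beta> X \<cdot>\<^bsub>D\<^esub> \<alpha> X)"

text \<open>The whiskerings \<open>H\<alpha>\<close> and \<open>\<alpha>K\<close> of a transformation \<open>\<alpha>\<close> by functors \<open>H\<close> and \<open>K\<close>.\<close>

definition whisker_left ::
  "('o1, 'a1) cat \<Rightarrow> ('o2, 'a2, 'o3, 'a3) func \<Rightarrow> ('o1 \<Rightarrow> 'a2) \<Rightarrow> 'o1 \<Rightarrow> 'a3" where
  "whisker_left C H \<alpha> = (\<lambda>X\<in>Obj C. FA H (\<alpha> X))"

definition whisker_right ::
  "('o1, 'a1) cat \<Rightarrow> ('o2 \<Rightarrow> 'a3) \<Rightarrow> ('o1, 'a1, 'o2, 'a2) func \<Rightarrow> 'o1 \<Rightarrow> 'a3" where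
  "whisker_right C \<alpha> K = (\<lambda>X\<in>Obj C. \<alpha> (FO K X))"

text \<open>The horizontal composite \<open>\<beta>\<alpha> : HF \<rightarrow> KG\<close> of \<open>\<alpha> : F \<rightarrow> G : C \<rightarrow> D\<close> and
  \<open>\<beta> : H \<rightarrow> K : D \<rightarrow> E\<close>, defined as \<open>\<beta>G \<circ> H\<alpha>\<close>; it equals \<open>K\<alpha> \<circ> \<beta>F\<close> by naturality of \<open>\<beta>\<close>
  (lemma \<open>hcomp_alt\<close>).\<close>

definition hcomp ::
  "('o1, 'a1) cat \<Rightarrow> ('o3, 'a3) cat \<Rightarrow> ('o1, 'a1, 'o2, 'a2) func \<Rightarrow> ('o2, 'a2, 'o3, 'a3) func
    \<Rightarrow> ('o2 \<Rightarrow> 'a3) \<Rightarrow> ('o1 \<Rightarrow> 'a2) \<Rightarrow> 'o1 \<Rightarrow> 'a3" where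
  "hcomp C E G H \<beta> \<alpha> = vcomp C E (whisker_right C \<beta> G) (whisker_left C H \<alpha>)"

lemma hcomp_alt:
  assumes "nat_trans C D F G \<alpha>" and "nat_trans D E H K \<beta>"
  shows "hcomp C E G H \<beta> \<alpha> = vcomp C E (whisker_left C K \<alpha>) (whisker_right C \<beta> F)"
  unfolding hcomp_def vcomp_def whisker_left_def whisker_right_def
  using nat_trans.naturality[OF assms(2) nat_trans.component_hom[OF assms(1)]]
  by (auto intro!: restrict_ext)

locale adjunction =
    L: cat_functor B A L + R: cat_functor A B R
    + unit: nat_trans B B id_func "R \<circ>\<^sub>F L" \<eta>
    + counit: nat_trans A A "L \<circ>\<^sub>F R" id_func \<epsilon>
  for B :: "('o1, 'a1) cat" and A :: "('o2, 'a2) cat" and L R \<eta> \<epsilon> +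
  assumes triangle_L:
      "vcomp B A (whisker_right B \<epsilon> L) (whisker_left B L \<eta>) = id_nt B A L"
    and triangle_R:
      "vcomp A B (whisker_left A R \<epsilon>) (whisker_right A \<eta> R) = id_nt A B R"

definition h_separable ::
  "('o1, 'a1) cat \<Rightarrow> ('o2, 'a2) cat \<Rightarrow> ('o1, 'a1, 'o2, 'a2) func \<Rightarrow> bool" where
  "h_separable B A F \<longleftrightarrow> (\<exists>P :: 'o1 \<Rightarrow> 'o1 \<Rightarrow> 'a2 \<Rightarrow> 'a1.
     (\<forall>X\<in>Obj B. \<forall>Y\<in>Obj B. P X Y \<in> hom A (FO F X) (FO F Y) \<rightarrow> hom B X Y) \<and>
     (\<forall>X\<in>Obj B. \<forall>Y\<in>Obj B. \<forall>X'\<in>Obj B. \<forall>Y'\<in>Obj B.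
        \<forall>h \<in> hom B X' X. \<forall>k \<in> hom B Y Y'. \<forall>f \<in> hom A (FO F X) (FO F Y).
          P X' Y' (FA F k \<cdot>\<^bsub>A\<^esub> f \<cdot>\<^bsub>A\<^esub> FA F h) = k \<cdot>\<^bsub>B\<^esub> P X Y f \<cdot>\<^bsub>B\<^esub> h) \<and>
     (\<forall>X\<in>Obj B. \<forall>Y\<in>Obj B. \<forall>f \<in> hom B X Y. P X Y (FA F f) = f) \<and>
     (\<forall>X\<in>Obj B. \<forall>Y\<in>Obj B. \<forall>Z\<in>Obj B.
        \<forall>g \<in> hom A (FO F X) (FO F Y). \<forall>f \<in> hom A (FO F Y) (FO F Z).
          P X Z (f \<cdot>\<^bsub>A\<^esub> g) = P Y Z f \<cdot>\<^bsub>B\<^esub> P X Y g))"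

end

theory Submission
  imports Defs
begin

text \<open>
  The adjunction turns the sets \<open>Hom\<^sub>A(LX, LY)\<close> into the sets \<open>Hom\<^sub>B(X, RLY)\<close>, so by the Yoneda
  lemma a natural family \<open>P\<^sub>X\<^sub>Y : Hom\<^sub>A(LX, LY) \<rightarrow> Hom\<^sub>B(X, Y)\<close> is the same thing as a natural
  transformation \<open>\<gamma> : RL \<rightarrow> Id\<close>. Explicitly, \<open>\<gamma>\<^sub>X = P(\<epsilon>\<^sub>L\<^sub>X)\<close> and \<open>P f = \<gamma>\<^sub>Y \<circ> Rf \<circ> \<eta>\<^sub>X\<close>. Under this
  correspondence \<open>P (Lf) = f\<close> becomes \<open>\<gamma>\<eta> = Id\<close>, and multiplicativity of \<open>P\<close> becomes the
  associativity-like law \<open>\<gamma>\<gamma> = \<gamma> \<circ> R\<epsilon>L\<close>.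

  In one direction (\<open>nat_trans_of_h_separable\<close>), the law comes from applying \<open>P\<close> to the naturality square
  \<open>\<epsilon>\<^sub>L\<^sub>X \<circ> \<epsilon>\<^sub>L\<^sub>R\<^sub>L\<^sub>X = \<epsilon>\<^sub>L\<^sub>X \<circ> LR\<epsilon>\<^sub>L\<^sub>X\<close>: \<open>P\<close> splits the left side into \<open>\<gamma>\<^sub>X \<circ> \<gamma>\<^sub>R\<^sub>L\<^sub>X\<close> by multiplicativity
  and the right side into \<open>\<gamma>\<^sub>X \<circ> R\<epsilon>\<^sub>L\<^sub>X\<close> by naturality. In the other direction
  (\<open>h_separable_of_nat_trans\<close>), the middle factor
  \<open>\<eta>\<^sub>Y \<circ> \<gamma>\<^sub>Y\<close> of \<open>P f \<circ> P g\<close> equals \<open>\<gamma>\<^sub>R\<^sub>L\<^sub>Y \<circ> RL\<eta>\<^sub>Y\<close> by naturality of \<open>\<gamma>\<close>; moving \<open>\<gamma>\<^sub>R\<^sub>L\<^sub>Y\<close> past \<open>Rf\<close> brings it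
  next to \<open>\<gamma>\<^sub>Z\<close>, where the law replaces it by \<open>R\<epsilon>\<^sub>L\<^sub>Z\<close>, and moving this back past \<open>RLRf\<close> cancels it
  against \<open>RL\<eta>\<^sub>Y\<close> by a triangle identity.

  Part (ii) is part (i) for the opposite categories: there \<open>R\<close> is left adjoint to \<open>L\<close>, with unit \<open>\<epsilon>\<close>
  and counit \<open>\<eta>\<close> (\<open>adjunction_op_cat\<close>), and h-separability is a self-dual notion.
\<close>

section \<open>Composition of arrows\<close>

text \<open>Side conditions on \<open>Dom\<close> and \<open>Cod\<close>, in contrast to membership in hom-sets, contain no
  variables beyond those of the equation, so that the simplifier can discharge them.\<close>

context category
begin

lemma seq_simps:
  assumes "f \<in> Arr C" "g \<in> Arr C" "Cod C f = Dom C g"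
  shows "g \<cdot>\<^bsub>C\<^esub> f \<in> Arr C" "Dom C (g \<cdot>\<^bsub>C\<^esub> f) = Dom C f" "Cod C (g \<cdot>\<^bsub>C\<^esub> f) = Cod C g"
  using Comp_hom[of f "Dom C f" "Cod C f" g "Cod C g"] assms by (auto simp: hom_def)

lemma seq_assoc:
  assumes "f \<in> Arr C" "g \<in> Arr C" "h \<in> Arr C" "Cod C f = Dom C g" "Cod C g = Dom C h"
  shows "(h \<cdot>\<^bsub>C\<^esub> g) \<cdot>\<^bsub>C\<^esub> f = h \<cdot>\<^bsub>C\<^esub> (g \<cdot>\<^bsub>C\<^esub> f)"
  using Comp_assoc[of f "Dom C f" "Cod C f" g "Cod C g" h "Cod C h"] assms by (auto simp: hom_def)

lemmas seq = seq_simps seq_assoc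

end

lemma homD:
  assumes "f \<in> hom C X Y"
  shows "f \<in> Arr C" "Dom C f = X" "Cod C f = Y"
  using assms by (auto simp: hom_def)

section \<open>Pointwise forms of equations between natural transformations\<close>

lemma restrict_eq_iff: "restrict f S = restrict g S \<longleftrightarrow> (\<forall>x\<in>S. f x = g x)"
  by (metis restrict_apply restrict_ext)

lemma vcomp_eq_id_nt_iff:
  "vcomp C D \<beta> \<alpha> = id_nt C D F \<longleftrightarrow> (\<forall>X\<in>Obj C. \<beta> X \<cdot>\<^bsub>D\<^esub> \<alpha> X = Idn D (FO F X))"
  by (simp add: vcomp_def id_nt_def restrict_eq_iff)

lemma vcomp_eq_iff:
  "vcomp C D \<beta> \<alpha> = vcomp C D \<beta>' \<alpha>' \<longleftrightarrow> (\<forall>X\<in>Obj C. \<beta> X \<cdot>\<^bsub>D\<^esub> \<alpha> X = \<beta>' X \<cdot>\<^bsub>D\<^esub> \<alpha>' X)"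
  by (simp add: vcomp_def restrict_eq_iff)

lemma func_simps [simp]:
  "FO id_func X = X" "FA id_func f = f"
  "FO (G \<circ>\<^sub>F F) X = FO G (FO F X)" "FA (G \<circ>\<^sub>F F) f = FA G (FA F f)"
  by (simp_all add: id_func_def comp_func_def)

section \<open>Heavily separable functors\<close>

lemma h_separableE:
  assumes "h_separable B A F"
  obtains P where "\<And>X Y f. \<lbrakk>X \<in> Obj B; Y \<in> Obj B; f \<in> hom A (FO F X) (FO F Y)\<rbrakk>
        \<Longrightarrow> P X Y f \<in> hom B X Y"
    and "\<And>X Y f. \<lbrakk>X \<in> Obj B; Y \<in> Obj B; f \<in> hom B X Y\<rbrakk> \<Longrightarrow> P X Y (FA F f) = f"
    and "\<And>X Y Z f g. \<lbrakk>X \<in> Obj B; Y \<in> Obj B; Z \<in> Obj B;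
          g \<in> hom A (FO F X) (FO F Y); f \<in> hom A (FO F Y) (FO F Z)\<rbrakk>
        \<Longrightarrow> P X Z (f \<cdot>\<^bsub>A\<^esub> g) = P Y Z f \<cdot>\<^bsub>B\<^esub> P X Y g"
proof -
  from assms show thesis
    unfolding h_separable_def Pi_iff
  proof (elim exE conjE, goal_cases)
    case (1 P)
    then show thesis by (intro that[of P]) blast+
  qed
qed

text \<open>Naturality of \<open>P\<close> is multiplicativity applied to arrows of the form \<open>Fh\<close> and \<open>Fk\<close>, which \<open>P\<close>
  sends back to \<open>h\<close> and \<open>k\<close>. So a heavily separable functor is given by maps on hom-sets that
  preserve composition and retract \<open>F\<close>.\<close>

lemma h_separableI:
  assumes "cat_functor B A F"
    and P_hom: "\<And>X Y f. \<lbrakk>X \<in> Obj B; Y \<in> Obj B; f \<in> hom A (FO F X) (FO F Y)\<rbrakk>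
        \<Longrightarrow> P X Y f \<in> hom B X Y"
    and P_F: "\<And>X Y f. \<lbrakk>X \<in> Obj B; Y \<in> Obj B; f \<in> hom B X Y\<rbrakk> \<Longrightarrow> P X Y (FA F f) = f"
    and P_mult: "\<And>X Y Z f g. \<lbrakk>X \<in> Obj B; Y \<in> Obj B; Z \<in> Obj B;
          g \<in> hom A (FO F X) (FO F Y); f \<in> hom A (FO F Y) (FO F Z)\<rbrakk>
        \<Longrightarrow> P X Z (f \<cdot>\<^bsub>A\<^esub> g) = P Y Z f \<cdot>\<^bsub>B\<^esub> P X Y g"
  shows "h_separable B A F"
proof -
  interpret cat_functor B A F by fact
  have "P X' Y' (FA F k \<cdot>\<^bsub>A\<^esub> f \<cdot>\<^bsub>A\<^esub> FA F h) = k \<cdot>\<^bsub>B\<^esub> P X Y f \<cdot>\<^bsub>B\<^esub> h"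
    if X: "X \<in> Obj B" and Y: "Y \<in> Obj B" and X': "X' \<in> Obj B" and Y': "Y' \<in> Obj B"
      and h: "h \<in> hom B X' X" and k: "k \<in> hom B Y Y'" and f: "f \<in> hom A (FO F X) (FO F Y)"
    for X Y X' Y' h k f
    using P_mult[OF X' X Y' FA_hom[OF h] cod.Comp_hom[OF f FA_hom[OF k]]]
      P_mult[OF X Y Y' f FA_hom[OF k]] P_F[OF X' X h] P_F[OF Y Y' k] by simp
  with P_hom P_F P_mult show ?thesis
    unfolding h_separable_def Pi_iff by (intro exI[of _ P] conjI ballI)
qed

section \<open>Heavy separability of the left adjoint\<close>

context adjunction
begin

lemma triangle_L_component: "X \<in> Obj B \<Longrightarrow> \<epsilon> (FO L X) \<cdot>\<^bsub>A\<^esub> FA L (\<eta> X) = Idn A (FO L X)"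
  using triangle_L by (simp add: vcomp_eq_id_nt_iff whisker_left_def whisker_right_def)

lemma unit_hom: "X \<in> Obj B \<Longrightarrow> \<eta> X \<in> hom B X (FO R (FO L X))"
  using unit.component_hom by simp

lemma counit_hom: "Z \<in> Obj A \<Longrightarrow> \<epsilon> Z \<in> hom A (FO L (FO R Z)) Z"
  using counit.component_hom by simp

lemma unit_nat: "f \<in> hom B X Y \<Longrightarrow> \<eta> Y \<cdot>\<^bsub>B\<^esub> f = FA R (FA L f) \<cdot>\<^bsub>B\<^esub> \<eta> X"
  using unit.naturality by simp

lemma counit_nat: "f \<in> hom A X Y \<Longrightarrow> \<epsilon> Y \<cdot>\<^bsub>A\<^esub> FA L (FA R f) = f \<cdot>\<^bsub>A\<^esub> \<epsilon> X"
  using counit.naturality by simp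

lemma RL_functor: "cat_functor B B (R \<circ>\<^sub>F L)"
  using unit.G.cat_functor_axioms .

lemma id_functor: "cat_functor B B id_func"
  using unit.F.cat_functor_axioms .

text \<open>For a transformation \<open>\<gamma> : RL \<rightarrow> Id\<close>, naturality at \<open>\<gamma>\<^sub>X\<close> itself lets \<open>\<gamma>\<gamma>\<close> be computed as
  \<open>\<gamma>\<^sub>X \<circ> \<gamma>\<^sub>R\<^sub>L\<^sub>X\<close>, which is the form that multiplicativity of \<open>P\<close> speaks about.\<close>

lemma hcomp_eq_iff:
  assumes "nat_trans B B (R \<circ>\<^sub>F L) id_func \<gamma>"
  shows "hcomp B B id_func (R \<circ>\<^sub>F L) \<gamma> \<gamma> = vcomp B B \<gamma> (whisker_left B R (whisker_right B \<epsilon> L))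
    \<longleftrightarrow> (\<forall>X\<in>Obj B. \<gamma> X \<cdot>\<^bsub>B\<^esub> \<gamma> (FO R (FO L X)) = \<gamma> X \<cdot>\<^bsub>B\<^esub> FA R (\<epsilon> (FO L X)))"
  unfolding hcomp_alt[OF assms assms]
  by (simp add: vcomp_eq_iff whisker_left_def whisker_right_def)

text \<open>Since \<open>\<gamma>\<^sub>X\<close> is the value of \<open>P\<close> at a counit, each property of \<open>\<gamma>\<close> is the image under \<open>P\<close> of one of
  the counit: naturality comes from naturality of \<open>\<epsilon>\<close>, the unit law from the triangle identity for
  \<open>L\<close>, and the law for \<open>\<gamma>\<gamma>\<close> from naturality of \<open>\<epsilon>\<close> at the arrow \<open>\<epsilon>\<^sub>L\<^sub>X\<close>.\<close>

lemma nat_trans_of_h_separable: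
  assumes "h_separable B A L"
  obtains \<gamma> where "nat_trans B B (R \<circ>\<^sub>F L) id_func \<gamma>"
    and "\<And>X. X \<in> Obj B \<Longrightarrow> \<gamma> X \<cdot>\<^bsub>B\<^esub> \<eta> X = Idn B X"
    and "\<And>X. X \<in> Obj B \<Longrightarrow>
      \<gamma> X \<cdot>\<^bsub>B\<^esub> \<gamma> (FO R (FO L X)) = \<gamma> X \<cdot>\<^bsub>B\<^esub> FA R (\<epsilon> (FO L X))"
proof -
  obtain P where P_hom: "\<And>X Y f. \<lbrakk>X \<in> Obj B; Y \<in> Obj B; f \<in> hom A (FO L X) (FO L Y)\<rbrakk>
        \<Longrightarrow> P X Y f \<in> hom B X Y"
    and P_L: "\<And>X Y f. \<lbrakk>X \<in> Obj B; Y \<in> Obj B; f \<in> hom B X Y\<rbrakk> \<Longrightarrow> P X Y (FA L f) = f"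
    and P_mult: "\<And>X Y Z f g. \<lbrakk>X \<in> Obj B; Y \<in> Obj B; Z \<in> Obj B;
          g \<in> hom A (FO L X) (FO L Y); f \<in> hom A (FO L Y) (FO L Z)\<rbrakk>
        \<Longrightarrow> P X Z (f \<cdot>\<^bsub>A\<^esub> g) = P Y Z f \<cdot>\<^bsub>B\<^esub> P X Y g"
    by (fact h_separableE[OF assms])
  \<comment> \<open>Separate naturality in each variable avoids inserting identity arrows on the other side.\<close>
  have P_left: "P X Z (FA L k \<cdot>\<^bsub>A\<^esub> f) = k \<cdot>\<^bsub>B\<^esub> P X Y f"
    if "X \<in> Obj B" "Y \<in> Obj B" "Z \<in> Obj B" "k \<in> hom B Y Z" "f \<in> hom A (FO L X) (FO L Y)"
    for X Y Z k f
    using P_mult[OF that(1-3,5) L.FA_hom[OF that(4)]] P_L[OF that(2-4)] by simp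
  have P_right: "P X Z (f \<cdot>\<^bsub>A\<^esub> FA L h) = P Y Z f \<cdot>\<^bsub>B\<^esub> h"
    if "X \<in> Obj B" "Y \<in> Obj B" "Z \<in> Obj B" "h \<in> hom B X Y" "f \<in> hom A (FO L Y) (FO L Z)"
    for X Y Z h f
    using P_mult[OF that(1-3) L.FA_hom[OF that(4)] that(5)] P_L[OF that(1,2,4)] by simp
  define \<gamma> where "\<gamma> X = P (FO R (FO L X)) X (\<epsilon> (FO L X))" for X
  have obj: "FO R (FO L X) \<in> Obj B" if "X \<in> Obj B" for X
    using that by (simp add: L.FO_Obj R.FO_Obj)
  have eps: "\<epsilon> (FO L X) \<in> hom A (FO L (FO R (FO L X))) (FO L X)" if "X \<in> Obj B" for X
    using that by (simp add: L.FO_Obj counit_hom)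
  have nat: "\<gamma> Y \<cdot>\<^bsub>B\<^esub> FA R (FA L f) = f \<cdot>\<^bsub>B\<^esub> \<gamma> X" if f: "f \<in> hom B X Y" for f X Y
  proof -
    have X: "X \<in> Obj B" and Y: "Y \<in> Obj B"
      using f L.dom.Dom_Obj L.dom.Cod_Obj by (auto simp: hom_def)
    have "\<gamma> Y \<cdot>\<^bsub>B\<^esub> FA R (FA L f) =
        P (FO R (FO L X)) Y (\<epsilon> (FO L Y) \<cdot>\<^bsub>A\<^esub> FA L (FA R (FA L f)))"
      unfolding \<gamma>_def
      using P_right[OF obj[OF X] obj[OF Y] Y R.FA_hom[OF L.FA_hom[OF f]] eps[OF Y]] by simp
    also have "\<dots> = P (FO R (FO L X)) Y (FA L f \<cdot>\<^bsub>A\<^esub> \<epsilon> (FO L X))"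
      using counit_nat[OF L.FA_hom[OF f]] by simp
    also have "\<dots> = f \<cdot>\<^bsub>B\<^esub> \<gamma> X"
      unfolding \<gamma>_def using P_left[OF obj[OF X] X Y f eps[OF X]] .
    finally show ?thesis .
  qed
  show thesis
  proof
    have "\<gamma> X \<in> hom B (FO R (FO L X)) X" if "X \<in> Obj B" for X
      unfolding \<gamma>_def using P_hom[OF obj[OF that] that eps[OF that]] .
    then show "nat_trans B B (R \<circ>\<^sub>F L) id_func \<gamma>"
      using nat RL_functor id_functor by (auto simp: nat_trans_def nat_trans_axioms_def)
  next
    fix X assume X: "X \<in> Obj B"
    have "\<gamma> X \<cdot>\<^bsub>B\<^esub> \<eta> X = P X X (\<epsilon> (FO L X) \<cdot>\<^bsub>A\<^esub> FA L (\<eta> X))"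
      unfolding \<gamma>_def using P_right[OF X obj[OF X] X unit_hom[OF X] eps[OF X]] by simp
    also have "\<dots> = P X X (FA L (Idn B X))"
      by (simp add: triangle_L_component X L.FA_Idn)
    also have "\<dots> = Idn B X"
      using P_L[OF X X L.dom.Idn_hom[OF X]] .
    finally show "\<gamma> X \<cdot>\<^bsub>B\<^esub> \<eta> X = Idn B X" .
  next
    fix X assume X: "X \<in> Obj B"
    let ?T = "\<lambda>X. FO R (FO L X)"
    have "\<gamma> X \<cdot>\<^bsub>B\<^esub> \<gamma> (?T X) = P (?T (?T X)) X (\<epsilon> (FO L X) \<cdot>\<^bsub>A\<^esub> \<epsilon> (FO L (?T X)))"
      unfolding \<gamma>_def using P_mult[OF obj[OF obj[OF X]] obj[OF X] X eps[OF obj[OF X]] eps[OF X]]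
      by simp
    also have "\<dots> = P (?T (?T X)) X (\<epsilon> (FO L X) \<cdot>\<^bsub>A\<^esub> FA L (FA R (\<epsilon> (FO L X))))"
      using counit_nat[OF eps[OF X]] by simp
    also have "\<dots> = \<gamma> X \<cdot>\<^bsub>B\<^esub> FA R (\<epsilon> (FO L X))"
      unfolding \<gamma>_def using P_right[OF obj[OF obj[OF X]] obj[OF X] X R.FA_hom[OF eps[OF X]] eps[OF X]] .
    finally show "\<gamma> X \<cdot>\<^bsub>B\<^esub> \<gamma> (?T X) = \<gamma> X \<cdot>\<^bsub>B\<^esub> FA R (\<epsilon> (FO L X))" .
  qed
qed

text \<open>\<open>P f\<close> is the transpose of \<open>f\<close> under the adjunction followed by \<open>\<gamma>\<close>. The unit law alone makes \<open>P\<close>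
  retract \<open>L\<close>; the law for \<open>\<gamma>\<gamma>\<close> serves to absorb the factor \<open>\<eta>\<^sub>Y \<circ> \<gamma>\<^sub>Y\<close> that stands between the
  transposes in \<open>P f \<circ> P g\<close>.\<close>

lemma h_separable_of_nat_trans:
  assumes \<gamma>: "nat_trans B B (R \<circ>\<^sub>F L) id_func \<gamma>"
    and \<gamma>_unit: "\<And>X. X \<in> Obj B \<Longrightarrow> \<gamma> X \<cdot>\<^bsub>B\<^esub> \<eta> X = Idn B X"
    and \<gamma>_mult: "\<And>X. X \<in> Obj B \<Longrightarrow>
      \<gamma> X \<cdot>\<^bsub>B\<^esub> \<gamma> (FO R (FO L X)) = \<gamma> X \<cdot>\<^bsub>B\<^esub> FA R (\<epsilon> (FO L X))"
  shows "h_separable B A L"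
proof -
  have \<gamma>_hom: "\<gamma> X \<in> hom B (FO R (FO L X)) X" if "X \<in> Obj B" for X
    using nat_trans.component_hom[OF \<gamma> that] by simp
  have \<gamma>_nat: "\<gamma> Y \<cdot>\<^bsub>B\<^esub> FA R (FA L f) = f \<cdot>\<^bsub>B\<^esub> \<gamma> X" if "f \<in> hom B X Y" for f X Y
    using nat_trans.naturality[OF \<gamma> that] by simp
  note seq = L.dom.seq
  define P where "P X Y f = \<gamma> Y \<cdot>\<^bsub>B\<^esub> (FA R f \<cdot>\<^bsub>B\<^esub> \<eta> X)" for X Y f
  have P_hom: "P X Y f \<in> hom B X Y"
    if "X \<in> Obj B" "Y \<in> Obj B" "f \<in> hom A (FO L X) (FO L Y)" for X Y f
    unfolding P_def
    using L.dom.Comp_hom L.dom.Comp_hom[OF unit_hom[OF that(1)] R.FA_hom[OF that(3)]]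
      \<gamma>_hom[OF that(2)] by blast
  have P_L: "P X Y (FA L f) = f" if X: "X \<in> Obj B" and Y: "Y \<in> Obj B" and f: "f \<in> hom B X Y"
    for X Y f
  proof -
    have "P X Y (FA L f) = (\<gamma> Y \<cdot>\<^bsub>B\<^esub> \<eta> Y) \<cdot>\<^bsub>B\<^esub> f"
      unfolding P_def unit_nat[OF f, symmetric]
      using homD[OF unit_hom[OF Y]] homD[OF \<gamma>_hom[OF Y]] homD[OF f] by (simp add: seq)
    then show ?thesis
      by (simp add: \<gamma>_unit[OF Y] L.dom.Idn_Comp[OF f])
  qed
  have P_mult: "P X Z (f \<cdot>\<^bsub>A\<^esub> g) = P Y Z f \<cdot>\<^bsub>B\<^esub> P X Y g"
    if X: "X \<in> Obj B" and Y: "Y \<in> Obj B" and Z: "Z \<in> Obj B"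
      and g: "g \<in> hom A (FO L X) (FO L Y)" and f: "f \<in> hom A (FO L Y) (FO L Z)" for X Y Z f g
  proof -
    let ?T = "\<lambda>X. FO R (FO L X)"
    have Rf: "FA R f \<in> hom B (?T Y) (?T Z)" and Rg: "FA R g \<in> hom B (?T X) (?T Y)"
      using R.FA_hom f g by auto
    have RLRf: "FA R (FA L (FA R f)) \<in> hom B (?T (?T Y)) (?T (?T Z))"
      using R.FA_hom L.FA_hom Rf by auto
    have RL\<eta>: "FA R (FA L (\<eta> Y)) \<in> hom B (?T Y) (?T (?T Y))"
      using R.FA_hom L.FA_hom unit_hom[OF Y] by auto
    have TY: "?T Y \<in> Obj B" and TZ: "?T Z \<in> Obj B"
      using Y Z by (simp_all add: L.FO_Obj R.FO_Obj)
    have LY: "FO L Y \<in> Obj A" and LZ: "FO L Z \<in> Obj A"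
      using Y Z by (simp_all add: L.FO_Obj)
    note homs = homD[OF Rf] homD[OF Rg] homD[OF RLRf] homD[OF RL\<eta>] homD[OF unit_hom[OF X]]
      homD[OF unit_hom[OF Y]] homD[OF \<gamma>_hom[OF Y]] homD[OF \<gamma>_hom[OF Z]]
      homD[OF \<gamma>_hom[OF TY]] homD[OF \<gamma>_hom[OF TZ]]
      homD[OF R.FA_hom[OF counit_hom[OF LY]]] homD[OF R.FA_hom[OF counit_hom[OF LZ]]]
    have R\<epsilon>_nat: "FA R (\<epsilon> (FO L Z)) \<cdot>\<^bsub>B\<^esub> FA R (FA L (FA R f)) =
        FA R f \<cdot>\<^bsub>B\<^esub> FA R (\<epsilon> (FO L Y))"
      using R.FA_Comp[OF L.FA_hom[OF Rf] counit_hom[OF LZ]] R.FA_Comp[OF counit_hom[OF LY] f]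
        counit_nat[OF f] by simp
    have triangle: "FA R (\<epsilon> (FO L Y)) \<cdot>\<^bsub>B\<^esub> FA R (FA L (\<eta> Y)) = Idn B (?T Y)"
      using R.FA_Comp[OF L.FA_hom[OF unit_hom[OF Y]] counit_hom[OF LY]]
        triangle_L_component[OF Y] R.FA_Idn[OF LY] by simp
    \<comment> \<open>The part of \<open>P f \<circ> P g\<close> to the left of \<open>Rg\<close> collapses to \<open>\<gamma> \<circ> Rf\<close>.\<close>
    have "\<gamma> Z \<cdot>\<^bsub>B\<^esub> (FA R f \<cdot>\<^bsub>B\<^esub> (\<eta> Y \<cdot>\<^bsub>B\<^esub> \<gamma> Y)) =
        \<gamma> Z \<cdot>\<^bsub>B\<^esub> (FA R f \<cdot>\<^bsub>B\<^esub> (\<gamma> (?T Y) \<cdot>\<^bsub>B\<^esub> FA R (FA L (\<eta> Y))))"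
      using \<gamma>_nat[OF unit_hom[OF Y]] by simp
    also have "\<dots> = \<gamma> Z \<cdot>\<^bsub>B\<^esub> ((FA R f \<cdot>\<^bsub>B\<^esub> \<gamma> (?T Y)) \<cdot>\<^bsub>B\<^esub> FA R (FA L (\<eta> Y)))"
      using homs by (simp add: seq)
    also have "\<dots> = \<gamma> Z \<cdot>\<^bsub>B\<^esub> ((\<gamma> (?T Z) \<cdot>\<^bsub>B\<^esub> FA R (FA L (FA R f))) \<cdot>\<^bsub>B\<^esub> FA R (FA L (\<eta> Y)))"
      using \<gamma>_nat[OF Rf] by simp
    also have "\<dots> = (\<gamma> Z \<cdot>\<^bsub>B\<^esub> \<gamma> (?T Z)) \<cdot>\<^bsub>B\<^esub> (FA R (FA L (FA R f)) \<cdot>\<^bsub>B\<^esub> FA R (FA L (\<eta> Y)))"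
      using homs by (simp add: seq)
    also have "\<dots> = (\<gamma> Z \<cdot>\<^bsub>B\<^esub> FA R (\<epsilon> (FO L Z))) \<cdot>\<^bsub>B\<^esub>
        (FA R (FA L (FA R f)) \<cdot>\<^bsub>B\<^esub> FA R (FA L (\<eta> Y)))"
      using \<gamma>_mult[OF Z] by simp
    also have "\<dots> = \<gamma> Z \<cdot>\<^bsub>B\<^esub>
        ((FA R (\<epsilon> (FO L Z)) \<cdot>\<^bsub>B\<^esub> FA R (FA L (FA R f))) \<cdot>\<^bsub>B\<^esub> FA R (FA L (\<eta> Y)))"
      using homs by (simp add: seq)
    also have "\<dots> = \<gamma> Z \<cdot>\<^bsub>B\<^esub> ((FA R f \<cdot>\<^bsub>B\<^esub> FA R (\<epsilon> (FO L Y))) \<cdot>\<^bsub>B\<^esub> FA R (FA L (\<eta> Y)))"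
      using R\<epsilon>_nat by simp
    also have "\<dots> = \<gamma> Z \<cdot>\<^bsub>B\<^esub> (FA R f \<cdot>\<^bsub>B\<^esub> (FA R (\<epsilon> (FO L Y)) \<cdot>\<^bsub>B\<^esub> FA R (FA L (\<eta> Y))))"
      using homs by (simp add: seq)
    also have "\<dots> = \<gamma> Z \<cdot>\<^bsub>B\<^esub> FA R f"
      by (simp add: triangle L.dom.Comp_Idn[OF Rf])
    finally have collapse: "\<gamma> Z \<cdot>\<^bsub>B\<^esub> (FA R f \<cdot>\<^bsub>B\<^esub> (\<eta> Y \<cdot>\<^bsub>B\<^esub> \<gamma> Y)) = \<gamma> Z \<cdot>\<^bsub>B\<^esub> FA R f" .
    have "P Y Z f \<cdot>\<^bsub>B\<^esub> P X Y g =
        (\<gamma> Z \<cdot>\<^bsub>B\<^esub> (FA R f \<cdot>\<^bsub>B\<^esub> (\<eta> Y \<cdot>\<^bsub>B\<^esub> \<gamma> Y))) \<cdot>\<^bsub>B\<^esub> (FA R g \<cdot>\<^bsub>B\<^esub> \<eta> X)"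
      unfolding P_def using homs by (simp add: seq)
    also have "\<dots> = (\<gamma> Z \<cdot>\<^bsub>B\<^esub> FA R f) \<cdot>\<^bsub>B\<^esub> (FA R g \<cdot>\<^bsub>B\<^esub> \<eta> X)"
      by (simp only: collapse)
    also have "\<dots> = P X Z (f \<cdot>\<^bsub>A\<^esub> g)"
      unfolding P_def R.FA_Comp[OF g f] using homs by (simp add: seq)
    finally show ?thesis by simp
  qed
  show ?thesis
    using L.cat_functor_axioms P_hom P_L P_mult by (rule h_separableI)
qed

theorem h_separable_left_adjoint_iff:
  "h_separable B A L \<longleftrightarrow>
    (\<exists>\<gamma>. nat_trans B B (R \<circ>\<^sub>F L) id_func \<gamma> \<and>
      vcomp B B \<gamma> \<eta> = id_nt B B id_func \<and>
      hcomp B B id_func (R \<circ>\<^sub>F L) \<gamma> \<gamma> = vcomp B B \<gamma> (whisker_left B R (whisker_right B \<epsilon> L)))"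
proof
  assume "h_separable B A L"
  then obtain \<gamma> where "nat_trans B B (R \<circ>\<^sub>F L) id_func \<gamma>"
    and "\<And>X. X \<in> Obj B \<Longrightarrow> \<gamma> X \<cdot>\<^bsub>B\<^esub> \<eta> X = Idn B X"
    and "\<And>X. X \<in> Obj B \<Longrightarrow>
      \<gamma> X \<cdot>\<^bsub>B\<^esub> \<gamma> (FO R (FO L X)) = \<gamma> X \<cdot>\<^bsub>B\<^esub> FA R (\<epsilon> (FO L X))"
    by (rule nat_trans_of_h_separable) (rule that)
  then show "\<exists>\<gamma>. nat_trans B B (R \<circ>\<^sub>F L) id_func \<gamma> \<and>
      vcomp B B \<gamma> \<eta> = id_nt B B id_func \<and>
      hcomp B B id_func (R \<circ>\<^sub>F L) \<gamma> \<gamma> = vcomp B B \<gamma> (whisker_left B R (whisker_right B \<epsilon> L))"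
    by (intro exI[of _ \<gamma>]) (simp add: hcomp_eq_iff vcomp_eq_id_nt_iff)
next
  assume "\<exists>\<gamma>. nat_trans B B (R \<circ>\<^sub>F L) id_func \<gamma> \<and>
      vcomp B B \<gamma> \<eta> = id_nt B B id_func \<and>
      hcomp B B id_func (R \<circ>\<^sub>F L) \<gamma> \<gamma> = vcomp B B \<gamma> (whisker_left B R (whisker_right B \<epsilon> L))"
  then obtain \<gamma> where \<gamma>: "nat_trans B B (R \<circ>\<^sub>F L) id_func \<gamma>"
    and "vcomp B B \<gamma> \<eta> = id_nt B B id_func"
    and "hcomp B B id_func (R \<circ>\<^sub>F L) \<gamma> \<gamma> = vcomp B B \<gamma> (whisker_left B R (whisker_right B \<epsilon> L))"
    by blast
  then show "h_separable B A L"
    by (intro h_separable_of_nat_trans[OF \<gamma>]) (simp_all add: hcomp_eq_iff vcomp_eq_id_nt_iff)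
qed

end

section \<open>Duality\<close>

definition op_cat :: "('o, 'a) cat \<Rightarrow> ('o, 'a) cat" where
  "op_cat C = \<lparr>Obj = Obj C, Arr = Arr C, Dom = Cod C, Cod = Dom C, Idn = Idn C,
    Comp = (\<lambda>g f. f \<cdot>\<^bsub>C\<^esub> g)\<rparr>"

lemma op_cat_simps [simp]:
  "Obj (op_cat C) = Obj C" "Arr (op_cat C) = Arr C" "Dom (op_cat C) = Cod C"
  "Cod (op_cat C) = Dom C" "Idn (op_cat C) = Idn C" "g \<cdot>\<^bsub>op_cat C\<^esub> f = f \<cdot>\<^bsub>C\<^esub> g"
  by (simp_all add: op_cat_def)

lemma hom_op_cat [simp]: "hom (op_cat C) X Y = hom C Y X"
  by (auto simp: hom_def)

lemma op_cat_op_cat [simp]: "op_cat (op_cat C) = C"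
  by (simp add: op_cat_def)

lemma category_op_cat:
  assumes "category C"
  shows "category (op_cat C)"
proof -
  interpret category C by fact
  show ?thesis
    by unfold_locales
      (auto simp: Dom_Obj Cod_Obj Idn_hom Comp_Idn Idn_Comp intro: Comp_hom Comp_assoc[symmetric])
qed

lemma cat_functor_op_cat:
  assumes "cat_functor C D F"
  shows "cat_functor (op_cat C) (op_cat D) F"
proof -
  interpret cat_functor C D F by fact
  show ?thesis
    by (auto simp: cat_functor_def cat_functor_axioms_def FO_Obj FA_Idn
        intro: category_op_cat dom.category_axioms cod.category_axioms FA_hom FA_Comp)
qed

lemma nat_trans_op_cat:
  assumes "nat_trans C D F G \<alpha>"
  shows "nat_trans (op_cat C) (op_cat D) G F \<alpha>"
proof -
  interpret nat_trans C D F G \<alpha> by fact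
  show ?thesis
    by (auto simp: nat_trans_def nat_trans_axioms_def naturality
        intro: cat_functor_op_cat F.cat_functor_axioms G.cat_functor_axioms component_hom)
qed

lemma nat_trans_op_cat_iff:
  "nat_trans (op_cat C) (op_cat D) G F \<alpha> \<longleftrightarrow> nat_trans C D F G \<alpha>"
  using nat_trans_op_cat[of C D F G \<alpha>] nat_trans_op_cat[of "op_cat C" "op_cat D" G F \<alpha>] by auto

lemma vcomp_op_cat [simp]: "vcomp (op_cat C) (op_cat D) \<beta> \<alpha> = vcomp C D \<alpha> \<beta>"
  by (simp add: vcomp_def)

lemma id_nt_op_cat [simp]: "id_nt (op_cat C) (op_cat D) F = id_nt C D F"
  by (simp add: id_nt_def)

lemma whisker_left_op_cat [simp]: "whisker_left (op_cat C) H \<alpha> = whisker_left C H \<alpha>"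
  by (simp add: whisker_left_def)

lemma whisker_right_op_cat [simp]: "whisker_right (op_cat C) \<alpha> K = whisker_right C \<alpha> K"
  by (simp add: whisker_right_def)

text \<open>Reversing arrows exchanges the two ways of computing a horizontal composite, so the interchange
  of the two is what makes horizontal composition self-dual.\<close>

lemma hcomp_op_cat:
  assumes "nat_trans C D F G \<alpha>" and "nat_trans D E H K \<beta>"
  shows "hcomp (op_cat C) (op_cat E) F K \<beta> \<alpha> = hcomp C E G H \<beta> \<alpha>"
  unfolding hcomp_alt[OF assms] by (simp add: hcomp_def)

lemma h_separable_op_cat:
  assumes "cat_functor B A F" and "h_separable B A F"
  shows "h_separable (op_cat B) (op_cat A) F"
proof -
  obtain P where P: "\<And>X Y f. \<lbrakk>X \<in> Obj B; Y \<in> Obj B; f \<in> hom A (FO F X) (FO F Y)\<rbrakk>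
        \<Longrightarrow> P X Y f \<in> hom B X Y"
      "\<And>X Y f. \<lbrakk>X \<in> Obj B; Y \<in> Obj B; f \<in> hom B X Y\<rbrakk> \<Longrightarrow> P X Y (FA F f) = f"
      "\<And>X Y Z f g. \<lbrakk>X \<in> Obj B; Y \<in> Obj B; Z \<in> Obj B;
          g \<in> hom A (FO F X) (FO F Y); f \<in> hom A (FO F Y) (FO F Z)\<rbrakk>
        \<Longrightarrow> P X Z (f \<cdot>\<^bsub>A\<^esub> g) = P Y Z f \<cdot>\<^bsub>B\<^esub> P X Y g"
    by (fact h_separableE[OF assms(2)])
  show ?thesis
    by (rule h_separableI[of _ _ _ "\<lambda>X Y. P Y X"]) (simp_all add: cat_functor_op_cat assms(1) P)
qed

lemma h_separable_op_cat_iff: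
  assumes "cat_functor B A F"
  shows "h_separable (op_cat B) (op_cat A) F \<longleftrightarrow> h_separable B A F"
  using h_separable_op_cat[OF assms] h_separable_op_cat[OF cat_functor_op_cat[OF assms]] by auto

lemma adjunction_op_cat:
  assumes "adjunction B A L R \<eta> \<epsilon>"
  shows "adjunction (op_cat A) (op_cat B) R L \<epsilon> \<eta>"
proof -
  interpret adjunction B A L R \<eta> \<epsilon> by fact
  show ?thesis
    by (auto simp: adjunction_def adjunction_axioms_def triangle_L triangle_R
        intro: cat_functor_op_cat nat_trans_op_cat L.cat_functor_axioms R.cat_functor_axioms
          unit.nat_trans_axioms counit.nat_trans_axioms)
qed

section \<open>Heavy separability of both adjoints\<close>

theorem theorem2p1:
  fixes B :: "('o1, 'a1) cat" and A :: "('o2, 'a2) cat"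
    and L :: "('o1, 'a1, 'o2, 'a2) func" and R :: "('o2, 'a2, 'o1, 'a1) func"
    and \<eta> :: "'o1 \<Rightarrow> 'a1" and \<epsilon> :: "'o2 \<Rightarrow> 'a2"
  assumes "adjunction B A L R \<eta> \<epsilon>"
  shows "(h_separable B A L \<longleftrightarrow>
      (\<exists>\<gamma>. nat_trans B B (R \<circ>\<^sub>F L) id_func \<gamma> \<and>
        vcomp B B \<gamma> \<eta> = id_nt B B id_func \<and>
        hcomp B B id_func (R \<circ>\<^sub>F L) \<gamma> \<gamma> =
          vcomp B B \<gamma> (whisker_left B R (whisker_right B \<epsilon> L)))) \<and>
    (h_separable A B R \<longleftrightarrow>
      (\<exists>\<delta>. nat_trans A A id_func (L \<circ>\<^sub>F R) \<delta> \<and>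
        vcomp A A \<epsilon> \<delta> = id_nt A A id_func \<and>
        hcomp A A (L \<circ>\<^sub>F R) id_func \<delta> \<delta> =
          vcomp A A (whisker_left A L (whisker_right A \<eta> R)) \<delta>))"
proof -
  interpret adjunction B A L R \<eta> \<epsilon> by fact
  interpret dual: adjunction "op_cat A" "op_cat B" R L \<epsilon> \<eta>
    using assms by (rule adjunction_op_cat)
  have "h_separable A B R \<longleftrightarrow>
      (\<exists>\<delta>. nat_trans A A id_func (L \<circ>\<^sub>F R) \<delta> \<and>
        vcomp A A \<epsilon> \<delta> = id_nt A A id_func \<and>
        hcomp A A (L \<circ>\<^sub>F R) id_func \<delta> \<delta> =
          vcomp A A (whisker_left A L (whisker_right A \<eta> R)) \<delta>)"
    using dual.h_separable_left_adjoint_iff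
    by (simp add: h_separable_op_cat_iff[OF R.cat_functor_axioms] nat_trans_op_cat_iff
        hcomp_op_cat cong: conj_cong)
  with h_separable_left_adjoint_iff show ?thesis by blast
qed

end
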